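(* For every design $k \in K_{ad}$, the true cost functional $\Phi(k) = \ell(u(k))$ and the discrete cost functional $\Phi_h(k) = \ell(u_h(k))$ satisfy $$\Phi(k) \ge \Phi_h(k).$$ Here $u(k) \in \mathcal{H}$ satisfies $a_k(u(k),v) = \ell(v)$ for all $v \in \mathcal{H}$, and $u_h(k) \in \mathcal{H}_h$ satisfies $a_k(u_h(k),v_h) = \ell(v_h)$ for all $v_h \in \mathcal{H}_h$.
   Context: $\Omega \subset \mathbb{R}^2$ is a polygonal Lipschitz domain with boundary $\partial\Omega = \overline{\Gamma_u \cup \Gamma_n}$, $\Gamma_u \cap \Gamma_n = \emptyset$. The solution space is $\mathcal{H} = \{u \in H^1(\Omega) : u = 0 \text{ on } \Gamma_u\}$. The set of admissible designs is $$K_{ad} = \Big\{k \in L^\infty(\Omega) : \gamma \le k \le 1 \text{ a.e. in } \Omega,\ \int_\Omega k = \mathbf{V}\Big\},$$ where $0 < \gamma \ll 1$ and $\mathbf{V}$ is a fixed volume constraint. For each $k \in K_{ad}$, $a_k(\cdot,\cdot) : \mathcal{H}\times\mathcal{H} \to \mathbb{R}$ is a coercive symmetric continuous bilinear form associated with $k$, and $\ell : \mathcal{H} \to \mathbb{R}$ is a bounded linear form. (In the heat conduction model problem, $a_k(u,v) = \int_\Omega k^p\, \nabla u\cdot\nabla v$ with $p \ge 1$ and $\ell(v) = \int_\Omega f v$ with $f \in L_2(\Omega)$; the result is formulated for general forms.) $\mathcal{H}_h \subset \mathcal{H}$ is a finite element subspace, i.e. a finite-dimensional linear subspace of $\mathcal{H}$.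 *)

theory Defs
  imports "HOL-Analysis.Analysis"
begin

section \<open>One-dimensional Hausdorff measure\<close>

text \<open>The guard \<open>bounded A\<close> is needed because \<^const>\<open>diameter\<close> is unspecified on unbounded sets.\<close>

definition diam_weight :: "real \<Rightarrow> 'a::metric_space set \<Rightarrow> ennreal" where
  "diam_weight \<delta> A = (if bounded A \<and> diameter A \<le> \<delta> then ennreal (diameter A) else top)"

definition hausdorff_outer :: "'a::metric_space set \<Rightarrow> ennreal" where
  "hausdorff_outer A = (SUP \<delta>\<in>{0<..}. outer_measure (Pow UNIV) (diam_weight \<delta>) A)"

definition hausdorff_measure :: "'a::metric_space measure" where
  "hausdorff_measure = measure_of UNIV (sets borel) hausdorff_outer"

text \<open>
  \<^const>\<open>measure_of\<close> yields the zero measure if its third argument is not countably additive; the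
  following facts (Caratheodory's criterion for metric outer measures) rule this out.
\<close>

lemma diam_weight_positive: "positive (Pow UNIV) (diam_weight \<delta>)" if "\<delta> > 0"
  using that by (simp add: positive_def diam_weight_def)

lemma diam_weight_increasing: "increasing (Pow UNIV) (diam_weight \<delta>)"
  unfolding increasing_def diam_weight_def
  by (auto intro!: ennreal_leI diameter_subset dest: bounded_subset)
     (meson diameter_subset order_trans)

context
begin

interpretation Pow_UNIV: sigma_algebra UNIV "Pow UNIV"
  by (rule sigma_algebra_Pow)

lemma hausdorff_outer_space:
  "outer_measure_space (Pow UNIV) (hausdorff_outer :: 'a::metric_space set \<Rightarrow> ennreal)"
proof -
  have *: "outer_measure_space (Pow UNIV)
      (outer_measure (Pow UNIV) (diam_weight \<delta> :: 'a set \<Rightarrow> ennreal))"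
    if "\<delta> > 0" for \<delta> :: real
    by (rule Pow_UNIV.outer_measure_space_outer_measure)
       (rule diam_weight_positive[OF that] diam_weight_increasing)+
  show ?thesis
    unfolding outer_measure_space_def
  proof (intro conjI)
    show "positive (Pow UNIV) (hausdorff_outer :: 'a set \<Rightarrow> ennreal)"
      using * unfolding positive_def hausdorff_outer_def outer_measure_space_def
      by (auto simp: bot_ennreal[symmetric] intro!: SUP_eq_const)
    show "increasing (Pow UNIV) (hausdorff_outer :: 'a set \<Rightarrow> ennreal)"
      using * unfolding increasing_def hausdorff_outer_def outer_measure_space_def
      by (auto intro!: SUP_mono)
    show "countably_subadditive (Pow UNIV) (hausdorff_outer :: 'a set \<Rightarrow> ennreal)"
      unfolding countably_subadditive_def
    proof (intro allI impI)
      fix A :: "nat \<Rightarrow> 'a set"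
      assume d: "disjoint_family A"
      show "hausdorff_outer (\<Union>i. A i) \<le> (\<Sum>i. hausdorff_outer (A i))"
        unfolding hausdorff_outer_def[of "\<Union>i. A i"]
      proof (rule SUP_least)
        fix \<delta> :: real assume "\<delta> \<in> {0<..}"
        then have "outer_measure (Pow UNIV) (diam_weight \<delta>) (\<Union>i. A i)
            \<le> (\<Sum>i. outer_measure (Pow UNIV) (diam_weight \<delta>) (A i))"
          using *[of \<delta>] d unfolding outer_measure_space_def countably_subadditive_def by auto
        also have "\<dots> \<le> (\<Sum>i. hausdorff_outer (A i))"
          unfolding hausdorff_outer_def using \<open>\<delta> \<in> {0<..}\<close>
          by (intro suminf_le summableI SUP_upper) auto
        finally show "outer_measure (Pow UNIV) (diam_weight \<delta>) (\<Union>i. A i)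
            \<le> (\<Sum>i. hausdorff_outer (A i))" .
      qed
    qed
  qed
qed

lemma hausdorff_outer_empty: "hausdorff_outer {} = 0"
  and hausdorff_outer_mono: "A \<subseteq> B \<Longrightarrow> hausdorff_outer A \<le> hausdorff_outer B"
  using hausdorff_outer_space
  unfolding outer_measure_space_def positive_def increasing_def by auto

lemma hausdorff_outer_subadd: "hausdorff_outer (A \<union> B) \<le> hausdorff_outer A + hausdorff_outer B"
proof -
  have "subadditive (Pow UNIV) (hausdorff_outer :: 'a set \<Rightarrow> _)"
    using hausdorff_outer_space unfolding outer_measure_space_def
    by (intro Pow_UNIV.countably_subadditive_subadditive) auto
  from subadditiveD[OF this, of A "B - A"]
  have "hausdorff_outer (A \<union> B) \<le> hausdorff_outer A + hausdorff_outer (B - A)"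
    by (auto simp: Un_Diff_cancel)
  also have "\<dots> \<le> hausdorff_outer A + hausdorff_outer B"
    by (intro add_left_mono hausdorff_outer_mono) auto
  finally show ?thesis .
qed

lemma hausdorff_outer_metric:
  fixes A B :: "'a::metric_space set"
  assumes "\<epsilon> > 0" and sep: "\<And>x y. x \<in> A \<Longrightarrow> y \<in> B \<Longrightarrow> \<epsilon> \<le> dist x y"
  shows "hausdorff_outer A + hausdorff_outer B \<le> hausdorff_outer (A \<union> B)"
proof -
  let ?O = "\<lambda>\<delta>. outer_measure (Pow UNIV) (diam_weight \<delta> :: 'a set \<Rightarrow> ennreal)"
  have mono: "?O \<delta>' X \<le> ?O \<delta> X" if "\<delta> \<le> \<delta>'" for \<delta> \<delta>' and X :: "'a set"
    unfolding outer_measure_def using that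
    by (intro INF_mono) (auto intro!: suminf_le summableI bexI simp: diam_weight_def)
  have *: "?O \<delta>1 A + ?O \<delta>2 B \<le> hausdorff_outer (A \<union> B)" if d: "\<delta>1 > 0" "\<delta>2 > 0" for \<delta>1 \<delta>2
  proof -
    define \<delta> where "\<delta> = min (\<epsilon> / 2) (min \<delta>1 \<delta>2)"
    have \<delta>: "0 < \<delta>" "\<delta> \<le> \<delta>1" "\<delta> \<le> \<delta>2" "\<delta> < \<epsilon>" using assms(1) d by (auto simp: \<delta>_def)
    have "?O \<delta>1 A + ?O \<delta>2 B \<le> ?O \<delta> A + ?O \<delta> B"
      by (intro add_mono mono \<delta>)
    also have "\<dots> \<le> ?O \<delta> (A \<union> B)"
      unfolding outer_measure_def[of _ _ "A \<union> B"]
    proof (rule INF_greatest, safe)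
      fix U :: "nat \<Rightarrow> 'a set"
      assume dis: "disjoint_family U" and cov: "A \<union> B \<subseteq> (\<Union>i. U i)"
      have A: "?O \<delta> A \<le> (\<Sum>i. diam_weight \<delta> (U i \<inter> A))"
        by (rule Pow_UNIV.outer_measure_le)
           (use cov \<delta> in \<open>auto simp: diam_weight_positive diam_weight_increasing simp del: Pow_UNIV\<close>)
      have B: "?O \<delta> B \<le> (\<Sum>i. diam_weight \<delta> (U i \<inter> B))"
        by (rule Pow_UNIV.outer_measure_le)
           (use cov \<delta> in \<open>auto simp: diam_weight_positive diam_weight_increasing simp del: Pow_UNIV\<close>)
      have "diam_weight \<delta> (U i \<inter> A) + diam_weight \<delta> (U i \<inter> B) \<le> diam_weight \<delta> (U i)" for i
      proof (cases "bounded (U i) \<and> diameter (U i) \<le> \<delta>")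
        case True
        have "U i \<inter> A = {} \<or> U i \<inter> B = {}"
        proof (rule ccontr)
          assume "\<not> ?thesis"
          then obtain x y where xy: "x \<in> U i" "x \<in> A" "y \<in> U i" "y \<in> B" by blast
          then have "dist x y \<le> diameter (U i)"
            using True diameter_bounded_bound by blast
          with sep[of x y] xy True \<delta> show False by auto
        qed
        moreover have "diam_weight \<delta> ({} :: 'a set) = 0" using \<delta> by (simp add: diam_weight_def)
        ultimately show ?thesis
          using increasingD[OF diam_weight_increasing, of "U i \<inter> A" "U i" \<delta>]
                increasingD[OF diam_weight_increasing, of "U i \<inter> B" "U i" \<delta>] by auto
      next
        case False
        then have "diam_weight \<delta> (U i) = top" by (auto simp: diam_weight_def)
        then show ?thesis by simp
      qed
      then have "(\<Sum>i. diam_weight \<delta> (U i \<inter> A) + diam_weight \<delta> (U i \<inter> B))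
          \<le> (\<Sum>i. diam_weight \<delta> (U i))"
        by (intro suminf_le summableI) auto
      then show "?O \<delta> A + ?O \<delta> B \<le> (\<Sum>i. diam_weight \<delta> (U i))"
        using A B by (subst (asm) suminf_add[symmetric]) (auto intro: order_trans[OF add_mono])
    qed
    also have "\<dots> \<le> hausdorff_outer (A \<union> B)"
      unfolding hausdorff_outer_def by (rule SUP_upper) (use \<delta> in auto)
    finally show ?thesis .
  qed
  have "hausdorff_outer A + ?O \<delta>2 B \<le> hausdorff_outer (A \<union> B)" if "\<delta>2 > 0" for \<delta>2
    unfolding hausdorff_outer_def[of A]
    by (subst ennreal_SUP_add_left[symmetric]) (auto intro!: SUP_least * that simp del: Pow_UNIV)
  then show ?thesis
    unfolding hausdorff_outer_def[of B]
    by (subst ennreal_SUP_add_right) (auto intro!: SUP_least simp del: Pow_UNIV)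
qed

lemma hausdorff_outer_sum:
  fixes A :: "nat \<Rightarrow> 'a::metric_space set"
  assumes "\<And>m n. m < n \<Longrightarrow> \<exists>\<epsilon>>0. \<forall>x\<in>A m. \<forall>y\<in>A n. \<epsilon> \<le> dist x y"
  shows "(\<Sum>i<n. hausdorff_outer (A i)) \<le> hausdorff_outer (\<Union>i<n. A i)"
proof (induction n)
  case (Suc n)
  have "\<exists>\<epsilon>>0. \<forall>x\<in>(\<Union>i<k. A i). \<forall>y\<in>A n. \<epsilon> \<le> dist x y" if "k \<le> n" for k
    using that
  proof (induction k)
    case (Suc k)
    then obtain e where e: "e > 0" "\<forall>x\<in>(\<Union>i<k. A i). \<forall>y\<in>A n. e \<le> dist x y" by auto
    obtain e' where e': "e' > 0" "\<forall>x\<in>A k. \<forall>y\<in>A n. e' \<le> dist x y" using assms[of k n] Suc by auto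
    have "\<forall>x\<in>(\<Union>i<Suc k. A i). \<forall>y\<in>A n. min e e' \<le> dist x y"
      using e e' by (auto simp: lessThan_Suc min_le_iff_disj)
    then show ?case using e e' by (intro exI[of _ "min e e'"]) simp
  qed (auto intro: exI[of _ 1])
  from this[of n] obtain e where "e > 0" "\<forall>x\<in>(\<Union>i<n. A i). \<forall>y\<in>A n. e \<le> dist x y" by auto
  then have "hausdorff_outer (\<Union>i<n. A i) + hausdorff_outer (A n)
      \<le> hausdorff_outer ((\<Union>i<n. A i) \<union> A n)"
    by (intro hausdorff_outer_metric) auto
  moreover have "(\<Union>i<n. A i) \<union> A n = (\<Union>i<Suc n. A i)" by (auto simp: less_Suc_eq)
  ultimately show ?case using Suc
    by (metis (no_types, lifting) add_right_mono order_trans sum.lessThan_Suc)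
qed (simp add: hausdorff_outer_empty)

lemma hausdorff_outer_closed:
  fixes C X :: "'a::metric_space set"
  assumes "closed C"
  shows "hausdorff_outer (X \<inter> C) + hausdorff_outer (X - C) \<le> hausdorff_outer X"
proof (cases "hausdorff_outer X = top \<or> C = {}")
  case True
  then show ?thesis by (auto simp: hausdorff_outer_empty)
next
  case False
  then have fin: "hausdorff_outer X < top" and "C \<noteq> {}" by (auto simp: less_top)
  define B where "B n = {x\<in>X. 1 / Suc n \<le> infdist x C}" for n :: nat
  define R where "R n = {x\<in>X. 1 / Suc (Suc n) \<le> infdist x C \<and> infdist x C < 1 / Suc n}" for n :: nat
  have far: "\<exists>\<epsilon>>0. \<forall>x\<in>R m. \<forall>y\<in>R n. \<epsilon> \<le> dist x y" if "Suc m < n" for m n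
  proof (intro exI conjI ballI)
    let ?e = "1 / Suc (Suc m) - 1 / Suc n :: real"
    show "?e > 0" using that by (simp add: frac_less2)
    fix x y assume "x \<in> R m" "y \<in> R n"
    then have "1 / Suc (Suc m) \<le> infdist x C" "infdist y C < 1 / Suc n" by (auto simp: R_def)
    with infdist_triangle[of x C y] show "?e \<le> dist x y" by linarith
  qed
  have bound: "(\<Sum>i<n. hausdorff_outer (R (2 * i + c))) \<le> hausdorff_outer X" for n c
  proof -
    have "(\<Sum>i<n. hausdorff_outer (R (2 * i + c))) \<le> hausdorff_outer (\<Union>i<n. R (2 * i + c))"
      by (rule hausdorff_outer_sum) (auto intro!: far)
    also have "\<dots> \<le> hausdorff_outer X"
      by (rule hausdorff_outer_mono) (auto simp: R_def)
    finally show ?thesis .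
  qed
  have "(\<Sum>i<n. hausdorff_outer (R i)) \<le> hausdorff_outer X + hausdorff_outer X" for n
  proof -
    have "(\<Sum>i<n. hausdorff_outer (R i)) \<le> (\<Sum>i<2*n. hausdorff_outer (R i))"
      by (intro sum_mono2) auto
    also have "\<dots> = (\<Sum>i<n. hausdorff_outer (R (2 * i))) + (\<Sum>i<n. hausdorff_outer (R (2 * i + 1)))"
      by (induction n) (auto simp: algebra_simps)
    also have "\<dots> \<le> hausdorff_outer X + hausdorff_outer X"
      using bound[of 0 n] bound[of 1 n] by (intro add_mono) auto
    finally show ?thesis .
  qed
  then have "(\<Sum>i. hausdorff_outer (R i)) \<le> hausdorff_outer X + hausdorff_outer X"
    by (intro suminf_le_const summableI)
  also have "\<dots> < top" using fin by simp
  finally have sfin: "(\<Sum>i. hausdorff_outer (R i)) \<noteq> top" by simp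
  have step: "hausdorff_outer (X \<inter> C) + hausdorff_outer (X - C) + (\<Sum>i<n. hausdorff_outer (R i))
      \<le> hausdorff_outer X + (\<Sum>i. hausdorff_outer (R i))" for n
  proof -
    let ?T = "\<Union>i. R (i + n)"
    have tail: "hausdorff_outer ?T \<le> (\<Sum>i. hausdorff_outer (R (i + n)))"
    proof -
      have "hausdorff_outer (\<Union>i. disjointed (\<lambda>i. R (i + n)) i)
          \<le> (\<Sum>i. hausdorff_outer (disjointed (\<lambda>i. R (i + n)) i))"
        using hausdorff_outer_space disjoint_family_disjointed
        unfolding outer_measure_space_def countably_subadditive_def by blast
      also have "\<dots> \<le> (\<Sum>i. hausdorff_outer (R (i + n)))"
        by (intro suminf_le summableI hausdorff_outer_mono disjointed_subset)
      finally show ?thesis by (simp add: UN_disjointed_eq)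
    qed
    have "X - C \<subseteq> B n \<union> ?T"
    proof
      fix x assume x: "x \<in> X - C"
      then have pos: "infdist x C > 0"
        using \<open>closed C\<close> \<open>C \<noteq> {}\<close> by (simp add: infdist_pos_not_in_closed)
      show "x \<in> B n \<union> ?T"
      proof (cases "x \<in> B n")
        case False
        then have lt: "infdist x C < 1 / Suc n" using x by (auto simp: B_def)
        define m where "m = (LEAST k. 1 / Suc k \<le> infdist x C)"
        obtain k where "1 / Suc k \<le> infdist x C"
          using nat_approx_posE[OF pos] less_imp_le by metis
        then have m: "1 / Suc m \<le> infdist x C" unfolding m_def by (rule LeastI)
        have "n < m"
        proof (rule ccontr)
          assume "\<not> n < m"
          then have "1 / real (Suc n) \<le> 1 / Suc m" by (intro divide_left_mono) auto
          with m lt show False by linarith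
        qed
        then obtain j where j: "m = Suc j" "n \<le> j" by (cases m) auto
        then have "infdist x C < 1 / Suc j"
          using not_less_Least[of j "\<lambda>k. 1 / Suc k \<le> infdist x C"] by (auto simp: m_def)
        with m j x have "x \<in> R j" by (auto simp: R_def)
        moreover have "j = (j - n) + n" using j by simp
        ultimately show ?thesis by (metis UN_I UNIV_I UnI2)
      qed simp
    qed
    then have "hausdorff_outer (X - C) \<le> hausdorff_outer (B n \<union> ?T)"
      by (rule hausdorff_outer_mono)
    also have "\<dots> \<le> hausdorff_outer (B n) + hausdorff_outer ?T"
      by (rule hausdorff_outer_subadd)
    also have "\<dots> \<le> hausdorff_outer (B n) + (\<Sum>i. hausdorff_outer (R (i + n)))"
      by (rule add_left_mono[OF tail])
    finally have "hausdorff_outer (X - C) \<le> hausdorff_outer (B n) + (\<Sum>i. hausdorff_outer (R (i + n)))" .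
    then have "hausdorff_outer (X \<inter> C) + hausdorff_outer (X - C) + (\<Sum>i<n. hausdorff_outer (R i))
        \<le> hausdorff_outer (X \<inter> C)
          + (hausdorff_outer (B n) + (\<Sum>i. hausdorff_outer (R (i + n)))) + (\<Sum>i<n. hausdorff_outer (R i))"
      by (intro add_mono order_refl)
    also have "\<dots> = (hausdorff_outer (X \<inter> C) + hausdorff_outer (B n)) + (\<Sum>i. hausdorff_outer (R i))"
      by (simp add: suminf_offset[OF summableI, of "\<lambda>i. hausdorff_outer (R i)" n] ac_simps)
    also have "hausdorff_outer (X \<inter> C) + hausdorff_outer (B n) \<le> hausdorff_outer ((X \<inter> C) \<union> B n)"
    proof (rule hausdorff_outer_metric[of "1 / Suc n"])
      fix x y assume "x \<in> X \<inter> C" "y \<in> B n"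
      then show "1 / Suc n \<le> dist x y"
        using infdist_le[of x C y] by (auto simp: B_def dist_commute)
    qed simp
    also have "hausdorff_outer ((X \<inter> C) \<union> B n) \<le> hausdorff_outer X"
      by (rule hausdorff_outer_mono) (auto simp: B_def)
    finally show ?thesis by (simp add: add_right_mono)
  qed
  have "(\<lambda>n. hausdorff_outer (X \<inter> C) + hausdorff_outer (X - C) + (\<Sum>i<n. hausdorff_outer (R i)))
      \<longlonglongrightarrow> hausdorff_outer (X \<inter> C) + hausdorff_outer (X - C) + (\<Sum>i. hausdorff_outer (R i))"
    by (intro tendsto_add tendsto_const summable_LIMSEQ summableI)
  then have "hausdorff_outer (X \<inter> C) + hausdorff_outer (X - C) + (\<Sum>i. hausdorff_outer (R i))
      \<le> hausdorff_outer X + (\<Sum>i. hausdorff_outer (R i))"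
    using step by (intro LIMSEQ_le_const2) auto
  then show ?thesis
    using sfin by (simp add: ennreal_add_left_cancel_le add.commute[of _ "\<Sum>i. hausdorff_outer (R i)"])
qed

lemma space_hausdorff_measure [simp]: "space hausdorff_measure = UNIV"
  and sets_hausdorff_measure [simp, measurable_cong]: "sets hausdorff_measure = sets borel"
  using sets.sigma_sets_eq[of borel] by (simp_all add: hausdorff_measure_def)

lemma emeasure_hausdorff_measure:
  fixes A :: "'a::metric_space set"
  assumes "A \<in> sets borel"
  shows "emeasure hausdorff_measure A = hausdorff_outer A"
proof -
  let ?L = "lambda_system UNIV (Pow UNIV) (hausdorff_outer :: 'a set \<Rightarrow> _)"
  have ms: "measure_space UNIV ?L hausdorff_outer"
    by (rule Pow_UNIV.caratheodory_lemma[OF hausdorff_outer_space])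
  then interpret L: sigma_algebra UNIV ?L by (simp add: measure_space_def)
  have "C \<in> ?L" if "closed C" for C :: "'a set"
  proof -
    have "hausdorff_outer X \<le> hausdorff_outer (X \<inter> C) + hausdorff_outer (X - C)" for X
      using hausdorff_outer_subadd[of "X \<inter> C" "X - C"] by (simp add: Int_Diff_Un)
    with hausdorff_outer_closed[OF that] show ?thesis
      by (auto simp: Pow_UNIV.lambda_system_eq simp del: Pow_UNIV intro!: antisym)
  qed
  then have "sigma_sets UNIV (Collect closed) \<subseteq> ?L"
    by (intro L.sigma_sets_subset) blast
  moreover have "sets (borel :: 'a measure) = sigma_sets UNIV (Collect closed)"
    unfolding borel_eq_closed by (rule sets_measure_of) simp
  ultimately have sub: "sets borel \<subseteq> ?L" by (simp only:)
  have "countably_additive (sets borel) (hausdorff_outer :: 'a set \<Rightarrow> _)"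
    using ms sub unfolding measure_space_def countably_additive_def by blast
  then show ?thesis
    using assms hausdorff_outer_empty
    by (intro emeasure_measure_of[OF hausdorff_measure_def]) (auto simp: positive_def)
qed

end


section \<open>Polygonal Lipschitz domains\<close>

text \<open>
  Near each boundary point the domain is the strict epigraph of a Lipschitz function in an
  orthonormal coordinate system \<open>(e, n)\<close> centred at that point.
\<close>

definition lipschitz_boundary :: "(real^2) set \<Rightarrow> bool" where
  "lipschitz_boundary \<Omega> \<longleftrightarrow>
     (\<forall>x\<in>frontier \<Omega>. \<exists>r>0. \<exists>e n L f. norm e = 1 \<and> norm n = 1 \<and> e \<bullet> n = 0 \<and>
        L-lipschitz_on (UNIV :: real set) f \<and>
        \<Omega> \<inter> ball x r = {y \<in> ball x r. f ((y - x) \<bullet> e) < (y - x) \<bullet> n})"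

definition polygonal_boundary :: "(real^2) set \<Rightarrow> bool" where
  "polygonal_boundary \<Omega> \<longleftrightarrow> (\<exists>E. finite E \<and> frontier \<Omega> = (\<Union>(p, q)\<in>E. closed_segment p q))"

definition polygonal_lipschitz_domain :: "(real^2) set \<Rightarrow> bool" where
  "polygonal_lipschitz_domain \<Omega> \<longleftrightarrow>
     open \<Omega> \<and> connected \<Omega> \<and> bounded \<Omega> \<and> \<Omega> \<noteq> {} \<and> lipschitz_boundary \<Omega> \<and> polygonal_boundary \<Omega>"

definition boundary_measure :: "(real^2) set \<Rightarrow> (real^2) measure" where
  "boundary_measure \<Omega> = restrict_space hausdorff_measure (frontier \<Omega>)"


section \<open>Sobolev space and traces\<close>

definition partial :: "2 \<Rightarrow> (real^2 \<Rightarrow> real) \<Rightarrow> real^2 \<Rightarrow> real" where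
  "partial i \<phi> x = frechet_derivative \<phi> (at x) (axis i 1)"

definition smooth :: "(real^2 \<Rightarrow> real) \<Rightarrow> bool" where
  "smooth \<phi> \<longleftrightarrow> (\<forall>is. foldr partial is \<phi> differentiable_on UNIV)"

definition test_functions :: "(real^2) set \<Rightarrow> (real^2 \<Rightarrow> real) set" where
  "test_functions \<Omega> = {\<phi>. smooth \<phi> \<and> (\<exists>K. compact K \<and> K \<subseteq> \<Omega> \<and> (\<forall>x. x \<notin> K \<longrightarrow> \<phi> x = 0))}"

definition L2 :: "'a measure \<Rightarrow> ('a \<Rightarrow> 'b::euclidean_space) set" where
  "L2 M = {f \<in> borel_measurable M. integrable M (\<lambda>x. (norm (f x))\<^sup>2)}"

definition L2_tendsto :: "'a measure \<Rightarrow> (nat \<Rightarrow> 'a \<Rightarrow> 'b::euclidean_space) \<Rightarrow> ('a \<Rightarrow> 'b) \<Rightarrow> bool" where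
  "L2_tendsto M F f \<longleftrightarrow> (\<lambda>n. \<integral>\<^sup>+x. ennreal ((norm (F n x - f x))\<^sup>2) \<partial>M) \<longlonglongrightarrow> 0"

definition has_weak_gradient :: "(real^2) set \<Rightarrow> (real^2 \<Rightarrow> real) \<Rightarrow> (real^2 \<Rightarrow> real^2) \<Rightarrow> bool" where
  "has_weak_gradient \<Omega> u g \<longleftrightarrow>
     (\<forall>\<phi>\<in>test_functions \<Omega>. \<forall>i.
        (LINT x|lebesgue_on \<Omega>. u x * partial i \<phi> x) = - (LINT x|lebesgue_on \<Omega>. g x $ i * \<phi> x))"

text \<open>
  Elements of the function spaces are represented by functions on the whole plane, of which only
  the values on \<open>\<Omega>\<close>, up to null sets, are relevant. Continuity of a linear or bilinear form with
  respect to the seminorm \<open>h1_norm\<close> makes it compatible with this identification. The gradient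
  chosen by \<open>SOME\<close> is unique up to null sets.
\<close>

definition H1 :: "(real^2) set \<Rightarrow> (real^2 \<Rightarrow> real) set" where
  "H1 \<Omega> = {u \<in> L2 (lebesgue_on \<Omega>). \<exists>g\<in>L2 (lebesgue_on \<Omega>). has_weak_gradient \<Omega> u g}"

definition weak_gradient :: "(real^2) set \<Rightarrow> (real^2 \<Rightarrow> real) \<Rightarrow> real^2 \<Rightarrow> real^2" where
  "weak_gradient \<Omega> u = (SOME g. g \<in> L2 (lebesgue_on \<Omega>) \<and> has_weak_gradient \<Omega> u g)"

definition h1_norm :: "(real^2) set \<Rightarrow> (real^2 \<Rightarrow> real) \<Rightarrow> real" where
  "h1_norm \<Omega> u = sqrt ((LINT x|lebesgue_on \<Omega>. (u x)\<^sup>2)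
                       + (LINT x|lebesgue_on \<Omega>. (norm (weak_gradient \<Omega> u x))\<^sup>2))"

text \<open>
  The trace operator is the continuous extension to \<open>H1 \<Omega>\<close> of the restriction to \<open>frontier \<Omega>\<close> of
  functions smooth up to the boundary, which are dense in \<open>H1 \<Omega>\<close> for Lipschitz \<open>\<Omega>\<close>.
\<close>

definition has_trace :: "(real^2) set \<Rightarrow> (real^2 \<Rightarrow> real) \<Rightarrow> (real^2 \<Rightarrow> real) \<Rightarrow> bool" where
  "has_trace \<Omega> u \<tau> \<longleftrightarrow> \<tau> \<in> L2 (boundary_measure \<Omega>) \<and>
     (\<exists>\<phi> g. (\<forall>n. smooth (\<phi> n)) \<and> g \<in> L2 (lebesgue_on \<Omega>) \<and> has_weak_gradient \<Omega> u g \<and>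
        L2_tendsto (lebesgue_on \<Omega>) \<phi> u \<and>
        L2_tendsto (lebesgue_on \<Omega>) (\<lambda>n x. \<chi> i. partial i (\<phi> n) x) g \<and>
        L2_tendsto (boundary_measure \<Omega>) \<phi> \<tau>)"

definition solution_space :: "(real^2) set \<Rightarrow> (real^2) set \<Rightarrow> (real^2 \<Rightarrow> real) set" where
  "solution_space \<Omega> \<Gamma>u =
     {u \<in> H1 \<Omega>. \<exists>\<tau>. has_trace \<Omega> u \<tau> \<and> (AE x in boundary_measure \<Omega>. x \<in> \<Gamma>u \<longrightarrow> \<tau> x = 0)}"

text \<open>Dimension is counted modulo equality almost everywhere.\<close>

definition finite_dim_subspace ::
  "(real^2) set \<Rightarrow> (real^2 \<Rightarrow> real) set \<Rightarrow> (real^2 \<Rightarrow> real) set \<Rightarrow> bool" where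
  "finite_dim_subspace \<Omega> W H \<longleftrightarrow> W \<subseteq> H \<and> (\<lambda>x. 0) \<in> W \<and>
     (\<forall>v\<in>W. \<forall>w\<in>W. (\<lambda>x. v x + w x) \<in> W) \<and> (\<forall>c. \<forall>v\<in>W. (\<lambda>x. c * v x) \<in> W) \<and>
     (\<exists>B\<subseteq>W. finite B \<and> (\<forall>v\<in>W. \<exists>c. AE x in lebesgue_on \<Omega>. v x = (\<Sum>b\<in>B. c b * b x)))"


section \<open>Designs, forms and states\<close>

definition admissible_designs :: "(real^2) set \<Rightarrow> real \<Rightarrow> real \<Rightarrow> (real^2 \<Rightarrow> real) set" where
  "admissible_designs \<Omega> \<gamma> V =
     {k \<in> borel_measurable (lebesgue_on \<Omega>).
        (\<exists>C. AE x in lebesgue_on \<Omega>. \<bar>k x\<bar> \<le> C) \<and>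
        (AE x in lebesgue_on \<Omega>. \<gamma> \<le> k x \<and> k x \<le> 1) \<and>
        (LINT x|lebesgue_on \<Omega>. k x) = V}"

definition linear_form_on :: "('a \<Rightarrow> real) set \<Rightarrow> (('a \<Rightarrow> real) \<Rightarrow> real) \<Rightarrow> bool" where
  "linear_form_on H l \<longleftrightarrow>
     (\<forall>v\<in>H. \<forall>w\<in>H. l (\<lambda>x. v x + w x) = l v + l w) \<and> (\<forall>c. \<forall>v\<in>H. l (\<lambda>x. c * v x) = c * l v)"

definition bounded_linear_form_on ::
  "('a \<Rightarrow> real) set \<Rightarrow> (('a \<Rightarrow> real) \<Rightarrow> real) \<Rightarrow> (('a \<Rightarrow> real) \<Rightarrow> real) \<Rightarrow> bool" where
  "bounded_linear_form_on H N l \<longleftrightarrow> linear_form_on H l \<and> (\<exists>C. \<forall>v\<in>H. \<bar>l v\<bar> \<le> C * N v)"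

definition bilinear_form_on ::
  "('a \<Rightarrow> real) set \<Rightarrow> (('a \<Rightarrow> real) \<Rightarrow> ('a \<Rightarrow> real) \<Rightarrow> real) \<Rightarrow> bool" where
  "bilinear_form_on H a \<longleftrightarrow>
     (\<forall>v\<in>H. linear_form_on H (\<lambda>u. a u v)) \<and> (\<forall>u\<in>H. linear_form_on H (\<lambda>v. a u v))"

definition symmetric_on ::
  "('a \<Rightarrow> real) set \<Rightarrow> (('a \<Rightarrow> real) \<Rightarrow> ('a \<Rightarrow> real) \<Rightarrow> real) \<Rightarrow> bool" where
  "symmetric_on H a \<longleftrightarrow> (\<forall>u\<in>H. \<forall>v\<in>H. a u v = a v u)"

definition continuous_form_on ::
  "('a \<Rightarrow> real) set \<Rightarrow> (('a \<Rightarrow> real) \<Rightarrow> real) \<Rightarrow> (('a \<Rightarrow> real) \<Rightarrow> ('a \<Rightarrow> real) \<Rightarrow> real) \<Rightarrow> bool" where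
  "continuous_form_on H N a \<longleftrightarrow> (\<exists>C. \<forall>u\<in>H. \<forall>v\<in>H. \<bar>a u v\<bar> \<le> C * N u * N v)"

definition coercive_on ::
  "('a \<Rightarrow> real) set \<Rightarrow> (('a \<Rightarrow> real) \<Rightarrow> real) \<Rightarrow> (('a \<Rightarrow> real) \<Rightarrow> ('a \<Rightarrow> real) \<Rightarrow> real) \<Rightarrow> bool" where
  "coercive_on H N a \<longleftrightarrow> (\<exists>\<alpha>>0. \<forall>v\<in>H. \<alpha> * (N v)\<^sup>2 \<le> a v v)"

definition solves_on ::
  "('a \<Rightarrow> real) set \<Rightarrow> (('a \<Rightarrow> real) \<Rightarrow> ('a \<Rightarrow> real) \<Rightarrow> real) \<Rightarrow> (('a \<Rightarrow> real) \<Rightarrow> real) \<Rightarrow>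
     ('a \<Rightarrow> real) \<Rightarrow> bool" where
  "solves_on W a l u \<longleftrightarrow> u \<in> W \<and> (\<forall>v\<in>W. a u v = l v)"

definition cost :: "('v \<Rightarrow> real) \<Rightarrow> ('d \<Rightarrow> 'v) \<Rightarrow> 'd \<Rightarrow> real" where
  "cost l u k = l (u k)"

end

theory Submission
  imports Defs
begin

text \<open>
  By Galerkin orthogonality the energy \<open>a\<^sub>k(e, e)\<close> of the error \<open>e = u(k) - u\<^sub>h(k)\<close> equals
  \<open>\<ell>(u(k)) - \<ell>(u\<^sub>h(k))\<close>, and coercivity makes it nonnegative. Since coercivity is available only
  on the solution space, one has to know that \<open>e\<close> belongs to it, that is, that weak gradients and
  traces add up.
\<close>

section \<open>Square-integrable functions and their convergence\<close>

lemma norm_add_square_le: "(norm (x + y))\<^sup>2 \<le> 2 * (norm x)\<^sup>2 + 2 * (norm y)\<^sup>2"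
  for x y :: "'a::real_normed_vector"
proof -
  have "(norm (x + y))\<^sup>2 \<le> (norm x + norm y)\<^sup>2"
    by (intro power_mono norm_triangle_ineq) simp
  also have "\<dots> \<le> 2 * (norm x)\<^sup>2 + 2 * (norm y)\<^sup>2"
    using sum_squares_bound[of "norm x" "norm y"] by (simp add: power2_sum)
  finally show ?thesis .
qed

text \<open>Twice the sum of the two squared norms is an integrable majorant; this elementary bound
  does the work of Minkowski's inequality.\<close>

lemma L2_add:
  fixes f g :: "'a \<Rightarrow> 'b::euclidean_space"
  assumes "f \<in> L2 M" "g \<in> L2 M"
  shows "(\<lambda>x. f x + g x) \<in> L2 M"
proof -
  have [measurable]: "f \<in> borel_measurable M" "g \<in> borel_measurable M"
    and int: "integrable M (\<lambda>x. (norm (f x))\<^sup>2)" "integrable M (\<lambda>x. (norm (g x))\<^sup>2)"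
    using assms by (auto simp: L2_def)
  have "integrable M (\<lambda>x. 2 * (norm (f x))\<^sup>2 + 2 * (norm (g x))\<^sup>2)"
    using int by simp
  then have "integrable M (\<lambda>x. (norm (f x + g x))\<^sup>2)"
    by (rule Bochner_Integration.integrable_bound) (auto simp: norm_add_square_le)
  then show ?thesis by (simp add: L2_def)
qed

text \<open>The squared distance between the sums is at most twice the sum of the squared distances,
  so its integral is squeezed to zero. Measurability of approximants and limits lets the nonnegative
  integral of the majorant split.\<close>

lemma L2_tendsto_add:
  fixes F G :: "nat \<Rightarrow> 'a \<Rightarrow> 'b::euclidean_space"
  assumes [measurable]: "\<And>n. F n \<in> borel_measurable M" "\<And>n. G n \<in> borel_measurable M"
    "f \<in> borel_measurable M" "g \<in> borel_measurable M"
    and lim: "L2_tendsto M F f" "L2_tendsto M G g"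
  shows "L2_tendsto M (\<lambda>n x. F n x + G n x) (\<lambda>x. f x + g x)"
proof -
  let ?I = "\<lambda>F f n. \<integral>\<^sup>+x. ennreal ((norm (F n x - f x))\<^sup>2) \<partial>M"
  have bound: "?I (\<lambda>n x. F n x + G n x) (\<lambda>x. f x + g x) n \<le> 2 * ?I F f n + 2 * ?I G g n" for n
  proof -
    have "ennreal ((norm ((F n x + G n x) - (f x + g x)))\<^sup>2)
        \<le> 2 * ennreal ((norm (F n x - f x))\<^sup>2) + 2 * ennreal ((norm (G n x - g x))\<^sup>2)" for x
    proof -
      have "ennreal ((norm ((F n x + G n x) - (f x + g x)))\<^sup>2)
          \<le> ennreal (2 * (norm (F n x - f x))\<^sup>2 + 2 * (norm (G n x - g x))\<^sup>2)"
        using norm_add_square_le[of "F n x - f x" "G n x - g x"]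
        by (intro ennreal_leI) (simp add: algebra_simps)
      also have "\<dots> = 2 * ennreal ((norm (F n x - f x))\<^sup>2) + 2 * ennreal ((norm (G n x - g x))\<^sup>2)"
        by (simp add: ennreal_plus ennreal_mult')
      finally show ?thesis .
    qed
    then have "?I (\<lambda>n x. F n x + G n x) (\<lambda>x. f x + g x) n
        \<le> (\<integral>\<^sup>+x. 2 * ennreal ((norm (F n x - f x))\<^sup>2) + 2 * ennreal ((norm (G n x - g x))\<^sup>2) \<partial>M)"
      by (intro nn_integral_mono)
    also have "\<dots> = 2 * ?I F f n + 2 * ?I G g n"
      by (simp add: nn_integral_add nn_integral_cmult)
    finally show ?thesis .
  qed
  \<comment> \<open>Multiplication by a constant is continuous on all of \<open>ennreal\<close> only
    for a finite constant, so the finiteness of 2 enters here.\<close>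
  have "(\<lambda>n. 2 * ?I F f n + 2 * ?I G g n) \<longlonglongrightarrow> 2 * 0 + 2 * 0"
    using lim unfolding L2_tendsto_def
    by (intro tendsto_add ennreal_tendsto_cmult) auto
  then have "(\<lambda>n. 2 * ?I F f n + 2 * ?I G g n) \<longlonglongrightarrow> 0" by simp
  from tendsto_sandwich[OF _ _ tendsto_const this] bound show ?thesis
    unfolding L2_tendsto_def by simp
qed

text \<open>On a finite measure space a square-integrable function is integrable, and a bounded
  factor preserves this. The bound is asked for on \<open>space M\<close> only, because a smooth
  function may be unbounded on the whole plane.\<close>

lemma L2_mult_bounded_integrable:
  fixes f h :: "'a \<Rightarrow> real"
  assumes "finite_measure M" "f \<in> L2 M" "h \<in> borel_measurable M"
    and bound: "\<And>x. x \<in> space M \<Longrightarrow> \<bar>h x\<bar> \<le> C"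
  shows "integrable M (\<lambda>x. f x * h x)"
proof -
  interpret finite_measure M by fact
  have [measurable]: "f \<in> borel_measurable M" "h \<in> borel_measurable M"
    and "integrable M (\<lambda>x. (f x)\<^sup>2)"
    using assms by (auto simp: L2_def)
  then have "integrable M f"
    using square_integrable_imp_integrable by blast
  then have "integrable M (\<lambda>x. f x * C)" by simp
  then show ?thesis
  proof (rule Bochner_Integration.integrable_bound)
    show "AE x in M. norm (f x * h x) \<le> norm (f x * C)"
    proof (rule AE_I2)
      fix x assume "x \<in> space M"
      then have "\<bar>h x\<bar> \<le> \<bar>C\<bar>" using bound by fastforce
      then show "norm (f x * h x) \<le> norm (f x * C)"
        by (simp add: abs_mult mult_left_mono)
    qed
  qed simp
qed

section \<open>Iterated partial derivatives of smooth functions\<close>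

lemma partial_add:
  assumes "\<phi> differentiable_on UNIV" "\<psi> differentiable_on UNIV"
  shows "partial i (\<lambda>x. \<phi> x + \<psi> x) = (\<lambda>x. partial i \<phi> x + partial i \<psi> x)"
proof
  fix x
  have "\<phi> differentiable at x" "\<psi> differentiable at x"
    using assms by (auto simp: differentiable_on_def)
  then have "((\<lambda>x. \<phi> x + \<psi> x) has_derivative
      (\<lambda>h. frechet_derivative \<phi> (at x) h + frechet_derivative \<psi> (at x) h)) (at x)"
    by (intro has_derivative_add) (simp_all add: frechet_derivative_works)
  \<comment> \<open>\<open>frechet_derivative\<close> chooses some derivative; uniqueness of the
    derivative identifies the choice made for the sum.\<close>
  then show "partial i (\<lambda>x. \<phi> x + \<psi> x) x = partial i \<phi> x + partial i \<psi> x"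
    by (simp add: partial_def frechet_derivative_at[symmetric])
qed

lemma smooth_differentiable_on: "smooth \<phi> \<Longrightarrow> \<phi> differentiable_on UNIV"
  \<comment> \<open>The empty list of directions stands for the function itself.\<close>
  unfolding smooth_def by (drule spec[of _ "[]"]) simp

lemma smooth_continuous_on: "smooth \<phi> \<Longrightarrow> continuous_on S \<phi>"
  using smooth_differentiable_on differentiable_imp_continuous_on continuous_on_subset by blast

lemma smooth_partial: "smooth \<phi> \<Longrightarrow> smooth (partial i \<phi>)"
  unfolding smooth_def
proof
  fix js assume "\<forall>is. foldr partial is \<phi> differentiable_on UNIV"
  \<comment> \<open>\<open>foldr\<close> applies the last entry of the list first, so appending
    \<open>i\<close> makes \<open>partial i\<close> the innermost derivative.\<close>
  from this[THEN spec, of "js @ [i]"] show "foldr partial js (partial i \<phi>) differentiable_on UNIV"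
    by simp
qed

text \<open>Induction on the list of directions: smoothness makes every iterated derivative
  differentiable, which is what \<open>partial_add\<close> requires for the next one.\<close>

lemma smooth_add:
  assumes "smooth \<phi>" "smooth \<psi>"
  shows "smooth (\<lambda>x. \<phi> x + \<psi> x)"
proof -
  have "foldr partial is (\<lambda>x. \<phi> x + \<psi> x) = (\<lambda>x. foldr partial is \<phi> x + foldr partial is \<psi> x)" for "is"
    using assms by (induction "is") (auto simp: smooth_def partial_add)
  then show ?thesis
    using assms by (auto simp: smooth_def intro: differentiable_on_add)
qed

section \<open>Measurability of continuous functions and integrability against smooth ones\<close>

lemma continuous_measurable_lebesgue_on:
  fixes \<phi> :: "'a::euclidean_space \<Rightarrow> 'b::euclidean_space"
  assumes "continuous_on UNIV \<phi>"
  shows "\<phi> \<in> borel_measurable (lebesgue_on \<Omega>)"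
proof -
  have "\<phi> \<in> borel_measurable borel" by (rule borel_measurable_continuous_onI[OF assms])
  then have "\<phi> \<in> borel_measurable lebesgue"
    by (intro measurable_completion) (simp add: measurable_lborel1)
  then show ?thesis by (rule measurable_restrict_space1)
qed

lemma continuous_measurable_boundary_measure:
  fixes \<phi> :: "real^2 \<Rightarrow> real"
  assumes "continuous_on UNIV \<phi>"
  shows "\<phi> \<in> borel_measurable (boundary_measure \<Omega>)"
  unfolding boundary_measure_def
  by (rule measurable_restrict_space1)
     (use borel_measurable_continuous_onI[OF assms] in \<open>simp cong: measurable_cong_sets\<close>)

text \<open>The closure of \<open>\<Omega>\<close> is compact, so \<open>\<phi>\<close> is bounded
  on it, and \<open>\<Omega>\<close> has finite measure.\<close>

lemma L2_mult_smooth_integrable: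
  assumes "open \<Omega>" "bounded \<Omega>" "f \<in> L2 (lebesgue_on \<Omega>)" "smooth \<phi>"
  shows "integrable (lebesgue_on \<Omega>) (\<lambda>x. f x * \<phi> x)"
proof -
  have "compact (\<phi> ` closure \<Omega>)"
    using assms by (intro compact_continuous_image smooth_continuous_on) auto
  then obtain C where C: "\<forall>y\<in>\<phi> ` closure \<Omega>. norm y \<le> C"
    using compact_imp_bounded bounded_iff by blast
  have "\<bar>\<phi> x\<bar> \<le> C" if "x \<in> \<Omega>" for x
    using C that closure_subset by fastforce
  moreover have "\<Omega> \<in> lmeasurable" using assms by (intro bounded_set_imp_lmeasurable) auto
  then have "finite_measure (lebesgue_on \<Omega>)" by (rule finite_measure_lebesgue_on)
  ultimately show ?thesis
    using assms
    by (intro L2_mult_bounded_integrable[where C = C])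
       (auto simp: continuous_measurable_lebesgue_on smooth_continuous_on)
qed

text \<open>Weak gradients are vector valued but are tested component by component; each component
  is dominated by the norm.\<close>

lemma L2_nth:
  fixes g :: "'a \<Rightarrow> real^'n"
  assumes "g \<in> L2 M"
  shows "(\<lambda>x. g x $ i) \<in> L2 M"
proof -
  have [measurable]: "g \<in> borel_measurable M" and int: "integrable M (\<lambda>x. (norm (g x))\<^sup>2)"
    using assms by (auto simp: L2_def)
  have [measurable]: "(\<lambda>x. g x $ i) \<in> borel_measurable M"
    by (rule borel_measurable_continuous_on[where f = "\<lambda>y. y $ i"]) (auto intro: continuous_on_component)
  have "integrable M (\<lambda>x. (g x $ i)\<^sup>2)"
    using int
  proof (rule Bochner_Integration.integrable_bound)
    have "(g x $ i)\<^sup>2 \<le> (norm (g x))\<^sup>2" for x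
      using component_le_norm_cart[of "g x" i] by (simp add: abs_le_square_iff[symmetric])
    then show "AE x in M. norm ((g x $ i)\<^sup>2) \<le> norm ((norm (g x))\<^sup>2)" by simp
  qed simp
  then show ?thesis by (simp add: L2_def)
qed

section \<open>Sums of weak gradients, of traces and of elements of the solution space\<close>

lemma has_weak_gradient_add:
  assumes "open \<Omega>" "bounded \<Omega>"
    and "u \<in> L2 (lebesgue_on \<Omega>)" "v \<in> L2 (lebesgue_on \<Omega>)"
    and "g \<in> L2 (lebesgue_on \<Omega>)" "h \<in> L2 (lebesgue_on \<Omega>)"
    and "has_weak_gradient \<Omega> u g" "has_weak_gradient \<Omega> v h"
  shows "has_weak_gradient \<Omega> (\<lambda>x. u x + v x) (\<lambda>x. g x + h x)"
  unfolding has_weak_gradient_def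
proof (intro ballI allI)
  fix \<phi> i assume \<phi>: "\<phi> \<in> test_functions \<Omega>"
  then have "smooth \<phi>" "smooth (partial i \<phi>)"
    by (auto simp: test_functions_def smooth_partial)
  \<comment> \<open>The Bochner integral of a non-integrable function is 0 by convention, so
    additivity of the integrals in \<open>has_weak_gradient\<close> rests on these four
    facts.\<close>
  then have "integrable (lebesgue_on \<Omega>) (\<lambda>x. u x * partial i \<phi> x)"
    "integrable (lebesgue_on \<Omega>) (\<lambda>x. v x * partial i \<phi> x)"
    "integrable (lebesgue_on \<Omega>) (\<lambda>x. g x $ i * \<phi> x)"
    "integrable (lebesgue_on \<Omega>) (\<lambda>x. h x $ i * \<phi> x)"
    using assms by (auto intro: L2_mult_smooth_integrable L2_nth)
  with assms(7,8) \<phi>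
  show "(LINT x|lebesgue_on \<Omega>. (u x + v x) * partial i \<phi> x) =
      - (LINT x|lebesgue_on \<Omega>. (g x + h x) $ i * \<phi> x)"
    by (simp add: has_weak_gradient_def distrib_right)
qed

lemma H1_add:
  assumes "open \<Omega>" "bounded \<Omega>" "u \<in> H1 \<Omega>" "v \<in> H1 \<Omega>"
  shows "(\<lambda>x. u x + v x) \<in> H1 \<Omega>"
  using assms unfolding H1_def by (auto intro!: L2_add intro: has_weak_gradient_add)

text \<open>A trace is witnessed by one smooth sequence converging at once to the function, to a
  weak gradient and to the boundary values. The sum of two such sequences converges to the sums in
  all three senses.\<close>

lemma has_trace_add:
  assumes "open \<Omega>" "bounded \<Omega>"
    and u: "u \<in> L2 (lebesgue_on \<Omega>)" "has_trace \<Omega> u \<tau>"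
    and v: "v \<in> L2 (lebesgue_on \<Omega>)" "has_trace \<Omega> v \<sigma>"
  shows "has_trace \<Omega> (\<lambda>x. u x + v x) (\<lambda>x. \<tau> x + \<sigma> x)"
proof -
  obtain \<phi> g where \<phi>: "\<And>n. smooth (\<phi> n)" "g \<in> L2 (lebesgue_on \<Omega>)" "has_weak_gradient \<Omega> u g"
      "L2_tendsto (lebesgue_on \<Omega>) \<phi> u"
      "L2_tendsto (lebesgue_on \<Omega>) (\<lambda>n x. \<chi> i. partial i (\<phi> n) x) g"
      "L2_tendsto (boundary_measure \<Omega>) \<phi> \<tau>" and \<tau>: "\<tau> \<in> L2 (boundary_measure \<Omega>)"
    using u unfolding has_trace_def by blast
  obtain \<psi> h where \<psi>: "\<And>n. smooth (\<psi> n)" "h \<in> L2 (lebesgue_on \<Omega>)" "has_weak_gradient \<Omega> v h"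
      "L2_tendsto (lebesgue_on \<Omega>) \<psi> v"
      "L2_tendsto (lebesgue_on \<Omega>) (\<lambda>n x. \<chi> i. partial i (\<psi> n) x) h"
      "L2_tendsto (boundary_measure \<Omega>) \<psi> \<sigma>" and \<sigma>: "\<sigma> \<in> L2 (boundary_measure \<Omega>)"
    using v unfolding has_trace_def by blast
  have meas: "\<zeta> \<in> borel_measurable (lebesgue_on \<Omega>)"
      "(\<lambda>x. \<chi> i. partial i \<zeta> x) \<in> borel_measurable (lebesgue_on \<Omega>)"
      "\<zeta> \<in> borel_measurable (boundary_measure \<Omega>)" if "smooth \<zeta>" for \<zeta>
    using that
    by (auto intro!: continuous_measurable_lebesgue_on continuous_measurable_boundary_measure
        continuous_on_vec_lambda smooth_continuous_on smooth_partial)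
  \<comment> \<open>\<open>has_trace\<close> says nothing about measurability of the function
    itself; for \<open>u\<close> and \<open>v\<close> it comes from the separate \<open>L2\<close>
    hypotheses.\<close>
  have meas_lim: "u \<in> borel_measurable (lebesgue_on \<Omega>)" "v \<in> borel_measurable (lebesgue_on \<Omega>)"
      "g \<in> borel_measurable (lebesgue_on \<Omega>)" "h \<in> borel_measurable (lebesgue_on \<Omega>)"
      "\<tau> \<in> borel_measurable (boundary_measure \<Omega>)" "\<sigma> \<in> borel_measurable (boundary_measure \<Omega>)"
    using u(1) v(1) \<phi>(2) \<psi>(2) \<tau> \<sigma> by (simp_all add: L2_def)
  \<comment> \<open>Brings the gradients of the summed sequence into the pointwise-sum form that
    \<open>L2_tendsto_add\<close> produces.\<close>
  have grad: "(\<lambda>n x. \<chi> i. partial i (\<lambda>x. \<phi> n x + \<psi> n x) x)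
      = (\<lambda>n x. (\<chi> i. partial i (\<phi> n) x) + (\<chi> i. partial i (\<psi> n) x))"
    using \<phi>(1) \<psi>(1) by (simp add: fun_eq_iff vec_eq_iff partial_add smooth_differentiable_on)
  have "L2_tendsto (lebesgue_on \<Omega>) (\<lambda>n x. \<chi> i. partial i (\<lambda>x. \<phi> n x + \<psi> n x) x) (\<lambda>x. g x + h x)"
    unfolding grad
    by (rule L2_tendsto_add[OF meas(2)[OF \<phi>(1)] meas(2)[OF \<psi>(1)] meas_lim(3,4) \<phi>(5) \<psi>(5)])
  moreover have "L2_tendsto (lebesgue_on \<Omega>) (\<lambda>n x. \<phi> n x + \<psi> n x) (\<lambda>x. u x + v x)"
    by (rule L2_tendsto_add[OF meas(1)[OF \<phi>(1)] meas(1)[OF \<psi>(1)] meas_lim(1,2) \<phi>(4) \<psi>(4)])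
  moreover have "L2_tendsto (boundary_measure \<Omega>) (\<lambda>n x. \<phi> n x + \<psi> n x) (\<lambda>x. \<tau> x + \<sigma> x)"
    by (rule L2_tendsto_add[OF meas(3)[OF \<phi>(1)] meas(3)[OF \<psi>(1)] meas_lim(5,6) \<phi>(6) \<psi>(6)])
  moreover have "has_weak_gradient \<Omega> (\<lambda>x. u x + v x) (\<lambda>x. g x + h x)"
    using assms \<phi> \<psi> by (intro has_weak_gradient_add)
  ultimately show ?thesis
    unfolding has_trace_def
    using \<phi>(1,2) \<psi>(1,2) L2_add[OF \<tau> \<sigma>] L2_add[OF \<phi>(2) \<psi>(2)] smooth_add
    by (intro conjI exI[of _ "\<lambda>n x. \<phi> n x + \<psi> n x"] exI[of _ "\<lambda>x. g x + h x"]) auto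
qed

text \<open>The sum of the two traces is a trace of the sum, and it vanishes on
  \<open>\<Gamma>u\<close> outside the union of two null sets.\<close>

lemma solution_space_add:
  assumes "open \<Omega>" "bounded \<Omega>" "u \<in> solution_space \<Omega> \<Gamma>u" "v \<in> solution_space \<Omega> \<Gamma>u"
  shows "(\<lambda>x. u x + v x) \<in> solution_space \<Omega> \<Gamma>u"
proof -
  obtain \<tau> \<sigma> where u: "u \<in> H1 \<Omega>" "has_trace \<Omega> u \<tau>"
      and v: "v \<in> H1 \<Omega>" "has_trace \<Omega> v \<sigma>"
      and zero: "AE x in boundary_measure \<Omega>. x \<in> \<Gamma>u \<longrightarrow> \<tau> x = 0"
        "AE x in boundary_measure \<Omega>. x \<in> \<Gamma>u \<longrightarrow> \<sigma> x = 0"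
    using assms unfolding solution_space_def by blast
  have "has_trace \<Omega> (\<lambda>x. u x + v x) (\<lambda>x. \<tau> x + \<sigma> x)"
    using assms u v by (intro has_trace_add) (auto simp: H1_def)
  moreover have "AE x in boundary_measure \<Omega>. x \<in> \<Gamma>u \<longrightarrow> \<tau> x + \<sigma> x = 0"
    using zero by eventually_elim auto
  ultimately show ?thesis
    using H1_add[OF assms(1,2) u(1) v(1)] unfolding solution_space_def by blast
qed

section \<open>The energy of the Galerkin error and the comparison of costs\<close>

lemma galerkin_compliance_le:
  assumes add: "\<And>v w. v \<in> H \<Longrightarrow> w \<in> H \<Longrightarrow> (\<lambda>x. v x + w x) \<in> H"
    and sub: "W \<subseteq> H" and scale: "\<And>c v. v \<in> W \<Longrightarrow> (\<lambda>x. c * v x) \<in> W"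
    and bil: "bilinear_form_on H a" and sym: "symmetric_on H a"
    and pos: "\<And>v. v \<in> H \<Longrightarrow> 0 \<le> a v v"
    and u: "solves_on H a l u" and w: "solves_on W a l w"
  shows "l w \<le> l u"
proof -
  \<comment> \<open>The error is written as a sum with a multiple by -1, the shape in which closure
    and linearity are stated. The multiple lies in \<open>W\<close> by \<open>scale\<close>, hence
    in \<open>H\<close>.\<close>
  let ?m = "\<lambda>x. -1 * w x"
  let ?e = "\<lambda>x. u x + ?m x"
  have uH: "u \<in> H" and wW: "w \<in> W" using u w by (auto simp: solves_on_def)
  then have wH: "w \<in> H" and mW: "?m \<in> W" using sub scale by blast+
  then have mH: "?m \<in> H" using sub by blast
  have eH: "?e \<in> H" using add[OF uH mH] .
  have add_left: "a (\<lambda>x. v x + w x) z = a v z + a w z"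
    and add_right: "a z (\<lambda>x. v x + w x) = a z v + a z w"
    if "v \<in> H" "w \<in> H" "z \<in> H" for v w z
    using bil that by (simp_all add: bilinear_form_on_def linear_form_on_def)
  have scale_left: "a (\<lambda>x. c * v x) z = c * a v z"
    and scale_right: "a z (\<lambda>x. c * v x) = c * a z v"
    if "v \<in> H" "z \<in> H" for c v z
    using bil that by (simp_all add: bilinear_form_on_def linear_form_on_def)
  note left = add_left[OF uH mH] scale_left[OF wH, of _ "-1"]
    and right = add_right[OF uH mH] scale_right[OF wH, of _ "-1"]
  \<comment> \<open>The first argument is split against the fixed second argument \<open>?e\<close>;
    then the second argument is split for \<open>u\<close> and for \<open>w\<close>.\<close>
  have "a ?e ?e = a u u - a u w - a w u + a w w"
    using left[OF eH] right[OF uH] right[OF wH] by linarith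
  \<comment> \<open>Since \<open>W\<close> lies in \<open>H\<close>, \<open>w\<close> is a
    legitimate test function for the problem solved by \<open>u\<close>. With symmetry and the
    discrete equation tested with \<open>w\<close> itself, the four terms collapse to
    \<open>l u - l w\<close>.\<close>
  moreover have "a u u = l u" "a u w = l w" using u uH wH by (auto simp: solves_on_def)
  moreover have "a w u = a u w" using sym uH wH by (simp add: symmetric_on_def)
  moreover have "a w w = l w" using w wW by (simp add: solves_on_def)
  ultimately show ?thesis using pos[OF eH] by linarith
qed

theorem corollary1:
  fixes \<Omega> \<Gamma>u \<Gamma>n :: "(real^2) set"
    and \<gamma> V :: real
    and a :: "(real^2 \<Rightarrow> real) \<Rightarrow> (real^2 \<Rightarrow> real) \<Rightarrow> (real^2 \<Rightarrow> real) \<Rightarrow> real"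
    and l :: "(real^2 \<Rightarrow> real) \<Rightarrow> real"
    and Hh :: "(real^2 \<Rightarrow> real) set"
    and u uh :: "(real^2 \<Rightarrow> real) \<Rightarrow> real^2 \<Rightarrow> real"
  assumes "polygonal_lipschitz_domain \<Omega>"
    and "frontier \<Omega> = closure (\<Gamma>u \<union> \<Gamma>n)"
    and "\<Gamma>u \<inter> \<Gamma>n = {}"
    and "0 < \<gamma>" and "\<gamma> < 1"
    and "\<And>k. k \<in> admissible_designs \<Omega> \<gamma> V \<Longrightarrow> bilinear_form_on (solution_space \<Omega> \<Gamma>u) (a k)"
    and "\<And>k. k \<in> admissible_designs \<Omega> \<gamma> V \<Longrightarrow> symmetric_on (solution_space \<Omega> \<Gamma>u) (a k)"
    and "\<And>k. k \<in> admissible_designs \<Omega> \<gamma> V \<Longrightarrow>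
           continuous_form_on (solution_space \<Omega> \<Gamma>u) (h1_norm \<Omega>) (a k)"
    and "\<And>k. k \<in> admissible_designs \<Omega> \<gamma> V \<Longrightarrow>
           coercive_on (solution_space \<Omega> \<Gamma>u) (h1_norm \<Omega>) (a k)"
    and "bounded_linear_form_on (solution_space \<Omega> \<Gamma>u) (h1_norm \<Omega>) l"
    and "finite_dim_subspace \<Omega> Hh (solution_space \<Omega> \<Gamma>u)"
    and "\<And>k. k \<in> admissible_designs \<Omega> \<gamma> V \<Longrightarrow> solves_on (solution_space \<Omega> \<Gamma>u) (a k) l (u k)"
    and "\<And>k. k \<in> admissible_designs \<Omega> \<gamma> V \<Longrightarrow> solves_on Hh (a k) l (uh k)"
  shows "\<forall>k\<in>admissible_designs \<Omega> \<gamma> V. cost l u k \<ge> cost l uh k"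
proof
  fix k assume k: "k \<in> admissible_designs \<Omega> \<gamma> V"
  \<comment> \<open>These two properties supply the finite measure and the bounds on smooth
    functions behind closure under sums.\<close>
  have "open \<Omega>" "bounded \<Omega>"
    using assms(1) by (auto simp: polygonal_lipschitz_domain_def)
  then have add: "\<And>v w. v \<in> solution_space \<Omega> \<Gamma>u \<Longrightarrow> w \<in> solution_space \<Omega> \<Gamma>u \<Longrightarrow>
      (\<lambda>x. v x + w x) \<in> solution_space \<Omega> \<Gamma>u"
    by (rule solution_space_add)
  obtain \<alpha> where "\<alpha> > 0" "\<And>v. v \<in> solution_space \<Omega> \<Gamma>u \<Longrightarrow> \<alpha> * (h1_norm \<Omega> v)\<^sup>2 \<le> a k v v"
    using assms(9)[OF k] by (auto simp: coercive_on_def)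
  \<comment> \<open>The coercivity bound is a positive constant times a square, so it yields the
    nonnegativity that the comparison of costs uses.\<close>
  then have pos: "\<And>v. v \<in> solution_space \<Omega> \<Gamma>u \<Longrightarrow> 0 \<le> a k v v"
    by (meson less_imp_le mult_nonneg_nonneg order_trans zero_le_power2)
  have sub: "Hh \<subseteq> solution_space \<Omega> \<Gamma>u"
    and scale: "\<And>c v. v \<in> Hh \<Longrightarrow> (\<lambda>x. c * v x) \<in> Hh"
    using assms(11) by (auto simp: finite_dim_subspace_def)
  show "cost l u k \<ge> cost l uh k"
    unfolding cost_def
    by (rule galerkin_compliance_le[OF add sub scale assms(6)[OF k] assms(7)[OF k] pos
          assms(12)[OF k] assms(13)[OF k]])
qed

end
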